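(* Let $r\in\mathbb{N}$ ($r\ge 1$), $1\le s<\infty$, $1\le p\le\infty$, and $\mu>2r-\frac1s+\frac32$ (with $1/p=0$ if $p=\infty$). For any constants $C_1,C_2>0$ there is a constant $c>0$, independent of $f$, $f^\delta$, $\delta$ and $N$, such that the following holds. Let $0<\delta<1$, let $f\in W_s^\mu$ with $\|f\|_{s,\mu}\le 1$, let $(\langle f^\delta,\varphi_k\rangle)_{k\ge0}$ be a sequence of real numbers such that $\xi_k=\langle f,\varphi_k\rangle-\langle f^\delta,\varphi_k\rangle$ satisfies $\|(\xi_k)_{k\ge 0}\|_{\ell_p}\le\delta$, and let $N\ge r$ be an integer with $N\asymp\delta^{-\frac{1}{\mu-1/p+1/s}}$, i.e. $C_1\delta^{-\frac{1}{\mu-1/p+1/s}}\le N\le C_2\delta^{-\frac{1}{\mu-1/p+1/s}}$. Then $$\|f^{(r)}-\mathcal{D}_N^{(r)}f^\delta\|_{C}\le c\,\delta^{\frac{\mu-2r+1/s-3/2}{\mu-1/p+1/s}}.$$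
   Context: $L_2$ is the usual space of real-valued square-integrable functions on $[-1,1]$ (Lebesgue measure); $C$ is the space of continuous real-valued functions on $[-1,1]$ with the maximum norm $\|\cdot\|_C$. The orthonormal Legendre polynomials on $[-1,1]$ are $\varphi_k(t)=\sqrt{k+1/2}\,(2^kk!)^{-1}\frac{d^k}{dt^k}[(t^2-1)^k]$, $k=0,1,2,\dots$. For $f\in L_2$, $\langle f,\varphi_k\rangle=\int_{-1}^1 f(t)\varphi_k(t)\,dt$. For $\mu>0$, $1\le s<\infty$, the weighted Wiener class is $W_s^\mu=\{f\in L_2:\ \|f\|_{s,\mu}^s:=\sum_{k=0}^\infty(\max\{1,k\})^{s\mu}|\langle f,\varphi_k\rangle|^s<\infty\}$. For $f\in W_s^\mu$, the derivative of order $r$ is represented as (and understood through) the series $f^{(r)}=\sum_{k=r}^\infty\langle f,\varphi_k\rangle\varphi_k^{(r)}$, with convergence in the metric in which the error is measured. $\ell_p$ is the usual space of real sequences with norm $\|x\|_{\ell_p}=(\sum_k|x_k|^p)^{1/p}$ for $p<\infty$ and $\sup_k|x_k|$ for $p=\infty$. The perturbed data $f^\delta$ are given only through a sequence of real numbers denoted $\langle f^\delta,\varphi_k\rangle$, $k\ge0$ (perturbed Fourier-Legendre coefficients). The truncation method is $\mathcal{D}_N^{(r)}f^\delta(t)=\sum_{k=r}^N\langle f^\delta,\varphi_k\rangle\varphi_k^{(r)}(t)$. *)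

theory Defs
  imports "HOL-Analysis.Analysis"
begin

definition L2_on_interval :: "(real \<Rightarrow> real) set" where
  "L2_on_interval =
     {f. f \<in> borel_measurable (lebesgue_on {-1..1}) \<and>
         integrable (lebesgue_on {-1..1}) (\<lambda>t. (f t)\<^sup>2)}"

definition legendre :: "nat \<Rightarrow> real \<Rightarrow> real" where
  "legendre k t =
     sqrt (real k + 1 / 2) / (2 ^ k * fact k) * (deriv ^^ k) (\<lambda>x. (x\<^sup>2 - 1) ^ k) t"

definition legendre_coeff :: "(real \<Rightarrow> real) \<Rightarrow> nat \<Rightarrow> real" where
  "legendre_coeff f k = (LINT t|lebesgue_on {-1..1}. f t * legendre k t)"

text \<open>The library function \<^const>\<open>suminf\<close> and suprema of unbounded sets of reals carry no
  information outside their domain of definition, so each norm below is to be read together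
  with the corresponding membership or continuity condition.\<close>

definition wiener_class :: "real \<Rightarrow> real \<Rightarrow> (real \<Rightarrow> real) set" where
  "wiener_class s \<mu> =
     {f \<in> L2_on_interval.
        summable (\<lambda>k. max 1 (real k) powr (s * \<mu>) * \<bar>legendre_coeff f k\<bar> powr s)}"

definition wiener_norm :: "real \<Rightarrow> real \<Rightarrow> (real \<Rightarrow> real) \<Rightarrow> real" where
  "wiener_norm s \<mu> f =
     (\<Sum>k. max 1 (real k) powr (s * \<mu>) * \<bar>legendre_coeff f k\<bar> powr s) powr (1 / s)"

text \<open>The exponent \<open>p\<close> of a sequence space ranges over the extended reals between
  \<open>1\<close> and \<open>\<infinity>\<close>.\<close>

definition lp_space :: "ereal \<Rightarrow> (nat \<Rightarrow> real) set" where
  "lp_space p =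
     {x. if p = \<infinity> then bounded (range x)
         else summable (\<lambda>k. \<bar>x k\<bar> powr real_of_ereal p)}"

definition lp_norm :: "ereal \<Rightarrow> (nat \<Rightarrow> real) \<Rightarrow> real" where
  "lp_norm p x =
     (if p = \<infinity> then (SUP k. \<bar>x k\<bar>)
      else (\<Sum>k. \<bar>x k\<bar> powr real_of_ereal p) powr (1 / real_of_ereal p))"

definition C_norm :: "(real \<Rightarrow> real) \<Rightarrow> real" where
  "C_norm h = (SUP t\<in>{-1..1}. \<bar>h t\<bar>)"

text \<open>The truncation method acts on a coefficient sequence \<open>a\<close>, which need not come from a
  function.\<close>

definition truncation :: "nat \<Rightarrow> nat \<Rightarrow> (nat \<Rightarrow> real) \<Rightarrow> real \<Rightarrow> real" where
  "truncation r N a t = (\<Sum>k=r..N. a k * (deriv ^^ r) (legendre k) t)"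

text \<open>\<open>has_C_derivative r f g\<close>: the termwise \<open>r\<close>-fold differentiated Fourier-Legendre series of
  \<open>f\<close> converges to \<open>g\<close> in the space of continuous functions on \<open>[-1, 1]\<close> (so \<open>g\<close> is unique on
  that interval). Its partial sums are the truncations of the exact coefficients.\<close>

definition has_C_derivative :: "nat \<Rightarrow> (real \<Rightarrow> real) \<Rightarrow> (real \<Rightarrow> real) \<Rightarrow> bool" where
  "has_C_derivative r f g \<longleftrightarrow>
     continuous_on {-1..1} g \<and>
     uniform_limit {-1..1} (\<lambda>n. truncation r n (legendre_coeff f)) g sequentially"

end

theory Submission
  imports Defs
begin

text \<open>
  The error splits into a bias, the tail beyond \<open>N\<close> of the differentiated Legendre series of \<open>f\<close>,
  and a propagated data error, the truncated sum over the perturbations \<open>\<xi>\<^sub>k\<close>. Both are controlled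
  by one analytic fact: on \<open>[-1, 1]\<close> the derivative of order \<open>r\<close> of the \<open>k\<close>-th orthonormal Legendre
  polynomial is, for \<open>k \<ge> 1\<close>, bounded in absolute value by \<open>2 k\<^bsup>2 r + 1/2\<^esup>\<close>
  (\<open>abs_higher_deriv_legendre_le\<close>). For the classical
  polynomials \<open>P\<^sub>k\<close> this reads \<open>\<bar>P\<^sub>k\<^bsup>(r)\<^esup>\<bar> \<le> k\<^bsup>2 r\<^esup>\<close>. The case \<open>r = 0\<close> follows from Legendre's differential
  equation by Sonin's monotonicity argument (\<open>abs_legendre_poly_le_1\<close>), and the recurrence
  \<open>P\<^sub>k\<^sub>+\<^sub>2' = (2 k + 3) P\<^sub>k\<^sub>+\<^sub>1 + P\<^sub>k'\<close> gives each further derivative at the cost of a factor \<open>k\<^sup>2\<close>.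

  Given this bound, only Hoelder's inequality is needed. Put \<open>\<sigma> = \<mu> - 2 r + 1/s - 3/2 > 0\<close>. The tail is
  at most a constant times \<open>N\<^bsup>-\<sigma>\<^esup>\<close> (\<open>truncation_tail_le\<close>); in particular the differentiated series
  converges uniformly. The data error is at most a constant times \<open>\<delta> N\<^sup>e\<close> with
  \<open>e = 2 r + 3/2 - 1/p\<close> (\<open>truncation_noise_le\<close>). The exponent that governs the choice of \<open>N\<close> is
  \<open>\<mu> - 1/p + 1/s = \<sigma> + e\<close>, exactly the one for which \<open>N\<^bsup>-\<sigma>\<^esup>\<close> and \<open>\<delta> N\<^sup>e\<close> balance; both are then
  of the order claimed.
\<close>

section \<open>Legendre polynomials as formal polynomials\<close>

definition rodrigues_base :: "real poly" where
  "rodrigues_base = [:-1, 0, 1:]"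

lemma pderiv_rodrigues_base: "pderiv rodrigues_base = [:0, 2:]"
  by (simp add: rodrigues_base_def pderiv_pCons)

definition legendre_poly :: "nat \<Rightarrow> real poly" where
  "legendre_poly n = smult (1 / (2 ^ n * fact n)) ((pderiv ^^ n) (rodrigues_base ^ n))"

text \<open>Rodrigues' formula is stated with iterated analytic derivatives. The differential equation and
  the recurrence that carry the growth estimates are algebraic identities, for which formal
  derivatives are the right setting.\<close>

lemma higher_deriv_poly:
  "(deriv ^^ n) (poly q) = poly ((pderiv ^^ n) q)" for q :: "real poly"
proof (induction n)
  case (Suc n)
  have "deriv (poly ((pderiv ^^ n) q)) = poly (pderiv ((pderiv ^^ n) q))"
    by (rule ext) (rule DERIV_imp_deriv[OF poly_DERIV])
  with Suc show ?case by simp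
qed simp

lemma legendre_eq_poly: "legendre k = poly (smult (sqrt (real k + 1/2)) (legendre_poly k))"
proof -
  have "(\<lambda>x::real. (x\<^sup>2 - 1) ^ k) = poly (rodrigues_base ^ k)"
    by (rule ext) (simp add: rodrigues_base_def power2_eq_square)
  then show ?thesis
    by (intro ext) (simp add: legendre_def legendre_poly_def higher_deriv_poly)
qed

section \<open>Boundedness of Legendre polynomials\<close>

text \<open>Write \<open>u = x\<^sup>2 - 1\<close>. The base case is the derivative of \<open>u (u\<^sup>n)' = 2 n x u\<^sup>n\<close>, and each
  further differentiation keeps the shape of the equation while it shifts the two scalar
  coefficients. For \<open>m = n\<close> the result is Legendre's differential equation.\<close>

lemma higher_pderiv_rodrigues_base_ode:
  "rodrigues_base * (pderiv ^^ (m + 2)) (rodrigues_base ^ n)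
   + smult (2 * (real m + 1 - real n)) ([:0, 1:] * (pderiv ^^ (m + 1)) (rodrigues_base ^ n))
   + smult (real m * (real m + 1) - 2 * real n * (real m + 1)) ((pderiv ^^ m) (rodrigues_base ^ n)) = 0"
proof (induction m)
  case 0
  let ?u = rodrigues_base
  note du = pderiv_rodrigues_base
  have *: "?u * pderiv (?u ^ n) = smult (2 * real n) ([:0, 1:] * ?u ^ n)"
    by (cases n) (simp_all add: pderiv_power_Suc du algebra_simps del: power_Suc, simp add: algebra_simps)
  have "pderiv (?u * pderiv (?u ^ n)) = pderiv (smult (2 * real n) ([:0, 1:] * ?u ^ n))"
    using * by simp
  then have "poly (pderiv (?u * pderiv (?u ^ n))) x = poly (pderiv (smult (2 * real n) ([:0, 1:] * ?u ^ n))) x" for x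
    by simp
  then show ?case
    by (intro poly_eq_poly_eq_iff[THEN iffD1] ext) (simp add: pderiv_mult du pderiv_smult pderiv_pCons algebra_simps)
next
  case (Suc m)
  let ?u = rodrigues_base
  note du = pderiv_rodrigues_base
  define w0 w1 w2 w3 where "w0 = (pderiv ^^ m) (?u ^ n)" and "w1 = pderiv w0"
    and "w2 = pderiv w1" and "w3 = pderiv w2"
  define A B where "A = 2 * (real m + 1 - real n)" and "B = real m * (real m + 1) - 2 * real n * (real m + 1)"
  have "?u * w2 + smult A ([:0, 1:] * w1) + smult B w0 = 0"
    using Suc by (simp add: w0_def w1_def w2_def A_def B_def)
  then have d0: "pderiv (?u * w2 + smult A ([:0, 1:] * w1) + smult B w0) = 0"
    by simp
  have "poly ?u x * poly w3 x + (A + 2) * x * poly w2 x + (A + B) * poly w1 x = 0" for x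
  proof -
    have "poly (pderiv (?u * w2 + smult A ([:0, 1:] * w1) + smult B w0)) x
      = poly ?u x * poly w3 x + (A + 2) * x * poly w2 x + (A + B) * poly w1 x"
      by (simp add: pderiv_mult du pderiv_add pderiv_smult pderiv_pCons
          w1_def[symmetric] w2_def[symmetric] w3_def[symmetric] algebra_simps)
    with d0 show ?thesis by simp
  qed
  then have "poly (?u * w3 + smult (A + 2) ([:0, 1:] * w2) + smult (A + B) w1) x = poly 0 x" for x
    by (simp add: mult.assoc mult.left_commute[of x])
  then have "?u * w3 + smult (A + 2) ([:0, 1:] * w2) + smult (A + B) w1 = 0"
    by (intro poly_eq_poly_eq_iff[THEN iffD1] ext)
  moreover have "A + 2 = 2 * (real (Suc m) + 1 - real n)"
    "A + B = real (Suc m) * (real (Suc m) + 1) - 2 * real n * (real (Suc m) + 1)"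
    by (simp_all add: A_def B_def algebra_simps)
  ultimately show ?case
    by (simp add: w0_def w1_def w2_def w3_def del: of_nat_Suc)
qed

text \<open>Each differentiation costs one factor \<open>x\<^sup>2 - 1\<close>; hence the derivatives of order below \<open>n\<close>
  vanish at \<open>1\<close> and \<open>-1\<close>, which gives the endpoint values of the Legendre polynomials.\<close>

lemma rodrigues_base_power_dvd_higher_pderiv:
  "m \<le> n \<Longrightarrow> rodrigues_base ^ (n - m) dvd (pderiv ^^ m) (rodrigues_base ^ n)"
proof (induction m)
  case (Suc m)
  then obtain q where q: "(pderiv ^^ m) (rodrigues_base ^ n) = rodrigues_base ^ Suc (n - Suc m) * q"
    by (auto simp: Suc_diff_Suc elim!: dvdE)
  have "pderiv (rodrigues_base ^ Suc (n - Suc m) * q) = rodrigues_base ^ (n - Suc m) *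
     (rodrigues_base * pderiv q + smult (real (Suc (n - Suc m))) (q * pderiv rodrigues_base))"
    unfolding pderiv_mult pderiv_power_Suc by (simp add: algebra_simps del: of_nat_Suc)
  then show ?case using q by simp
qed simp

lemma higher_pderiv_X_mult:
  "(pderiv ^^ Suc n) ([:0, 1:] * q) = [:0, 1:] * (pderiv ^^ Suc n) q + smult (real (Suc n)) ((pderiv ^^ n) q)"
  for q :: "real poly"
proof (induction n)
  case 0
  then show ?case by (simp add: pderiv_mult pderiv_pCons)
next
  case (Suc n)
  have "(pderiv ^^ Suc (Suc n)) ([:0, 1:] * q) = pderiv ((pderiv ^^ Suc n) ([:0, 1:] * q))" by simp
  also have "\<dots> = [:0, 1:] * (pderiv ^^ Suc (Suc n)) q + smult (real (Suc (Suc n))) ((pderiv ^^ Suc n) q)"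
    unfolding Suc
    by (intro poly_eq_poly_eq_iff[THEN iffD1] ext)
       (simp add: pderiv_add pderiv_mult pderiv_smult pderiv_pCons algebra_simps)
  finally show ?case .
qed

text \<open>From \<open>(u\<^bsup>n+1\<^esup>)' = 2 (n + 1) x u\<^sup>n\<close> and Leibniz' rule, passing from \<open>n\<close> to \<open>n + 1\<close> multiplies
  the value at an endpoint \<open>x\<close> by \<open>x\<close>: the remaining term contains a derivative of \<open>u\<^sup>n\<close> of order
  \<open>n - 1\<close>, which vanishes there.\<close>

lemma legendre_poly_endpoint:
  assumes "x = 1 \<or> x = -1"
  shows "\<bar>poly (legendre_poly n) x\<bar> = 1"
proof (induction n)
  case 0
  then show ?case by (simp add: legendre_poly_def)
next
  case (Suc n)
  let ?u = rodrigues_base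
  have ux: "poly ?u x = 0" using assms by (auto simp: rodrigues_base_def)
  note du = pderiv_rodrigues_base
  have "pderiv (?u ^ Suc n) = smult (2 * real (Suc n)) ([:0, 1:] * ?u ^ n)"
    unfolding pderiv_power_Suc du
    by (intro poly_eq_poly_eq_iff[THEN iffD1] ext) (simp add: algebra_simps)
  then have "(pderiv ^^ Suc n) (?u ^ Suc n) = smult (2 * real (Suc n)) ((pderiv ^^ n) ([:0, 1:] * ?u ^ n))"
    by (simp only: funpow_Suc_right o_def higher_pderiv_smult)
  moreover have "poly ((pderiv ^^ n) ([:0, 1:] * ?u ^ n)) x = x * poly ((pderiv ^^ n) (?u ^ n)) x"
  proof (cases n)
    case (Suc m)
    have "?u dvd (pderiv ^^ m) (?u ^ n)"
      using rodrigues_base_power_dvd_higher_pderiv[of m n] Suc by simp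
    then have "poly ((pderiv ^^ m) (?u ^ n)) x = 0" using ux by (auto elim!: dvdE)
    then show ?thesis unfolding Suc higher_pderiv_X_mult by (simp add: Suc)
  qed simp
  ultimately have "poly (legendre_poly (Suc n)) x = x * poly (legendre_poly n) x"
    by (simp add: legendre_poly_def del: funpow.simps power_Suc of_nat_Suc)
       (simp add: field_simps)
  with Suc assms show ?case by (auto simp: abs_mult)
qed

lemma legendre_poly_ode:
  "(x\<^sup>2 - 1) * poly (pderiv (pderiv (legendre_poly n))) x + 2 * x * poly (pderiv (legendre_poly n)) x
     = real n * (real n + 1) * poly (legendre_poly n) x"
proof -
  define c :: real where "c = 1 / (2 ^ n * fact n)"
  have "poly (smult c (rodrigues_base * (pderiv ^^ (n + 2)) (rodrigues_base ^ n)
   + smult (2 * (real n + 1 - real n)) ([:0, 1:] * (pderiv ^^ (n + 1)) (rodrigues_base ^ n))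
   + smult (real n * (real n + 1) - 2 * real n * (real n + 1)) ((pderiv ^^ n) (rodrigues_base ^ n)))) x = 0"
    unfolding higher_pderiv_rodrigues_base_ode by simp
  moreover have "poly rodrigues_base x = x\<^sup>2 - 1" by (simp add: rodrigues_base_def power2_eq_square)
  ultimately show ?thesis
    unfolding legendre_poly_def c_def[symmetric] pderiv_smult by (simp add: algebra_simps)
qed

text \<open>Sonin's argument. Along solutions of Legendre's equation the function
  \<open>g = P\<^sup>2 + (1 - x\<^sup>2) P'\<^sup>2 / (n (n + 1))\<close> satisfies \<open>g' = 2 x P'\<^sup>2 / (n (n + 1))\<close>. So \<open>g\<close> increases
  away from \<open>0\<close> towards both endpoints, where it equals \<open>1\<close>, and it dominates \<open>P\<^sup>2\<close>.\<close>

lemma abs_legendre_poly_le_1: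
  assumes "\<bar>t\<bar> \<le> 1"
  shows "\<bar>poly (legendre_poly n) t\<bar> \<le> 1"
proof (cases "n = 0")
  case True
  then show ?thesis by (simp add: legendre_poly_def)
next
  case False
  define P where "P = poly (legendre_poly n)"
  define P' where "P' = poly (pderiv (legendre_poly n))"
  define P'' where "P'' = poly (pderiv (pderiv (legendre_poly n)))"
  define l where "l = real n * (real n + 1)"
  have l: "l > 0" using False by (simp add: l_def)
  define g where "g x = (P x)\<^sup>2 + (1 - x\<^sup>2) * (P' x)\<^sup>2 / l" for x
  have dP: "DERIV P x :> P' x" "DERIV P' x :> P'' x" for x
    unfolding P_def P'_def P''_def by simp_all
  have ode: "(x\<^sup>2 - 1) * P'' x + 2 * x * P' x = l * P x" for x
    unfolding P_def P'_def P''_def l_def by (rule legendre_poly_ode)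
  have dg: "DERIV g x :> 2 * x * (P' x)\<^sup>2 / l" for x
  proof -
    have "DERIV g x :> 2 * P x * P' x + (- (2 * x) * (P' x)\<^sup>2 + (1 - x\<^sup>2) * (2 * P' x * P'' x)) / l"
      unfolding g_def using l by (auto intro!: derivative_eq_intros dP simp: field_simps)
    moreover have "(1 - x\<^sup>2) * (2 * P' x * P'' x) = 2 * P' x * (2 * x * P' x - l * P x)"
      unfolding ode[symmetric] by (simp add: algebra_simps)
    then have "2 * P x * P' x + (- (2 * x) * (P' x)\<^sup>2 + (1 - x\<^sup>2) * (2 * P' x * P'' x)) / l = 2 * x * (P' x)\<^sup>2 / l"
      using l by (simp add: field_simps power2_eq_square)
    ultimately show ?thesis by simp
  qed
  have g_end: "g x = 1" if "x = 1 \<or> x = -1" for x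
    using legendre_poly_endpoint[OF that, of n] that
    by (auto simp: g_def P_def abs_square_eq_1)
  have "g t \<le> 1"
  proof (cases "t \<ge> 0")
    case True
    have "g t \<le> g 1"
      by (rule DERIV_nonneg_imp_nondecreasing[of t 1 g]) (use assms True l dg in \<open>auto intro!: exI divide_nonneg_pos\<close>)
    then show ?thesis using g_end by simp
  next
    case False
    have "2 * x * (P' x)\<^sup>2 / l \<le> 0" if "x \<le> t" for x
      by (rule divide_nonpos_pos[OF mult_nonpos_nonneg]) (use that False l in auto)
    then have "g t \<le> g (-1)"
      using assms False by (intro DERIV_nonpos_imp_nonincreasing[of "-1" t g]) (auto intro: dg)
    then show ?thesis using g_end by simp
  qed
  moreover have "(P t)\<^sup>2 \<le> g t"
    using l assms by (simp add: g_def abs_square_le_1)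
  ultimately show ?thesis by (simp add: P_def abs_square_le_1[symmetric])
qed

section \<open>Growth of the derivatives of Legendre polynomials\<close>

text \<open>Differentiating \<open>u\<^bsup>n+2\<^esup>\<close> twice and replacing \<open>x\<^sup>2\<close> by \<open>u + 1\<close> expresses it through \<open>u\<^bsup>n+1\<^esup>\<close> and
  \<open>u\<^sup>n\<close>; \<open>n + 1\<close> further derivatives turn this into a recurrence that trades a derivative of a
  Legendre polynomial for Legendre polynomials of lower degree.\<close>

lemma pderiv_legendre_poly_rec:
  "pderiv (legendre_poly (n + 2)) = smult (2 * real n + 3) (legendre_poly (n + 1)) + pderiv (legendre_poly n)"
proof -
  let ?u = rodrigues_base
  note du = pderiv_rodrigues_base
  have "pderiv (pderiv (?u ^ (n + 2))) = smult (2 * (real n + 2) * (2 * real n + 3)) (?u ^ (n + 1))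
      + smult (4 * (real n + 2) * (real n + 1)) (?u ^ n)"
  proof (intro poly_eq_poly_eq_iff[THEN iffD1] ext)
    fix x
    have "poly (pderiv (pderiv (?u ^ (n + 2)))) x = 2 * (real n + 2) * (poly ?u x ^ (n+1) + (real n + 1) * 2 * x\<^sup>2 * poly ?u x ^ n)"
      by (simp add: pderiv_power_Suc du pderiv_mult pderiv_smult pderiv_pCons algebra_simps power2_eq_square del: power_Suc)
    also have "x\<^sup>2 = poly ?u x + 1" by (simp add: rodrigues_base_def power2_eq_square)
    finally show "poly (pderiv (pderiv (?u ^ (n + 2)))) x = poly (smult (2 * (real n + 2) * (2 * real n + 3)) (?u ^ (n + 1))
      + smult (4 * (real n + 2) * (real n + 1)) (?u ^ n)) x"
      by (simp add: algebra_simps)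
  qed
  then have "(pderiv ^^ (n + 1)) (pderiv (pderiv (?u ^ (n + 2)))) =
      smult (2 * (real n + 2) * (2 * real n + 3)) ((pderiv ^^ (n + 1)) (?u ^ (n + 1)))
      + smult (4 * (real n + 2) * (real n + 1)) ((pderiv ^^ (n + 1)) (?u ^ n))"
    by (simp only: higher_pderiv_add higher_pderiv_smult)
  moreover have "(pderiv ^^ (n + 1)) (pderiv (pderiv q)) = pderiv ((pderiv ^^ (n + 2)) q)" for q :: "real poly"
    by (induction n) simp_all
  ultimately have d: "pderiv ((pderiv ^^ (n + 2)) (?u ^ (n + 2))) =
      smult (2 * (real n + 2) * (2 * real n + 3)) ((pderiv ^^ (n + 1)) (?u ^ (n + 1)))
      + smult (4 * (real n + 2) * (real n + 1)) (pderiv ((pderiv ^^ n) (?u ^ n)))"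
    by simp
  define c K :: real where "c = 1 / (2 ^ (n + 2) * fact (n + 2))" and "K = 2 ^ n * fact n"
  have K: "K > 0" by (simp add: K_def)
  \<comment> \<open>The linear factors \<open>n + 2\<close> and \<open>n + 1\<close> are kept as atoms \<open>a\<close> and \<open>b\<close>, so that they cancel
    before they are multiplied out.\<close>
  have a: "c = 1 / (4 * a * b * K)" "2 ^ (n + 1) * fact (n + 1) = 2 * b * K"
    if "a = real n + 2" "b = real n + 1" for a b
    using that by (simp_all add: c_def K_def algebra_simps)
  have "1 / (2 * b * K) = 1 / (4 * a * b * K) * (2 * a)" "1 / K = 1 / (4 * a * b * K) * (4 * a * b)"
    if "a > 0" "b > 0" for a b
    using K that by simp_all
  from this[of "real n + 2" "real n + 1"]
  have "1 / (2 ^ (n + 1) * fact (n + 1)) = c * (2 * (real n + 2))"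
       "1 / (2 ^ n * fact n) = c * (4 * (real n + 2) * (real n + 1))"
    unfolding a[OF refl refl] K_def[symmetric] by (simp_all only:)
  note c = this
  have "smult c (pderiv ((pderiv ^^ (n + 2)) (?u ^ (n + 2)))) =
      smult (c * (2 * (real n + 2) * (2 * real n + 3))) ((pderiv ^^ (n + 1)) (?u ^ (n + 1)))
      + smult (c * (4 * (real n + 2) * (real n + 1))) (pderiv ((pderiv ^^ n) (?u ^ n)))"
    using d by (simp add: smult_add_right del: power_Suc)
  then show ?thesis
    unfolding legendre_poly_def pderiv_smult c c_def[symmetric] by (simp add: mult_ac)
qed

text \<open>The recurrence writes \<open>P\<^sub>k'\<close> as a sum of terms \<open>(2 j + 1) P\<^sub>j\<close> with \<open>j < k\<close>, whose weights
  add up to at most \<open>k\<^sup>2\<close>. Hence every derivative costs a factor \<open>k\<^sup>2\<close>. This is the order of growth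
  given by Markov's inequality, without its general proof.\<close>

lemma abs_higher_pderiv_legendre_poly_le:
  assumes t: "\<bar>t\<bar> \<le> 1"
  shows "\<bar>poly ((pderiv ^^ r) (legendre_poly k)) t\<bar> \<le> real k ^ (2 * r)"
proof (induction r arbitrary: k)
  case 0
  show ?case using abs_legendre_poly_le_1[OF t] by simp
next
  case (Suc r)
  show ?case
  proof (induction k rule: induct_nat_012)
    case 0
    have "(pderiv ^^ Suc r) (legendre_poly 0) = 0"
      by (simp add: funpow_Suc_right legendre_poly_def pderiv_1 del: funpow.simps)
    then show ?case by simp
  next
    case 1
    have "legendre_poly 1 = [:0, 1:]" by (simp add: legendre_poly_def rodrigues_base_def pderiv_pCons)
    then have "(pderiv ^^ Suc r) (legendre_poly 1) = (pderiv ^^ r) 1"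
      by (simp add: funpow_Suc_right pderiv_pCons one_pCons del: funpow.simps)
    moreover have "(pderiv ^^ r) 1 = (if r = 0 then 1 else 0 :: real poly)"
      by (cases r) (simp_all add: funpow_Suc_right del: funpow.simps)
    ultimately show ?case by simp
  next
    case (ge2 k)
    have "(pderiv ^^ Suc r) (legendre_poly (k + 2)) = smult (2 * real k + 3) ((pderiv ^^ r) (legendre_poly (k + 1)))
      + (pderiv ^^ Suc r) (legendre_poly k)"
      unfolding funpow_Suc_right o_def pderiv_legendre_poly_rec higher_pderiv_add higher_pderiv_smult ..
    then have "\<bar>poly ((pderiv ^^ Suc r) (legendre_poly (k + 2))) t\<bar>
       \<le> (2 * real k + 3) * \<bar>poly ((pderiv ^^ r) (legendre_poly (k + 1))) t\<bar> + \<bar>poly ((pderiv ^^ Suc r) (legendre_poly k)) t\<bar>"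
      using abs_triangle_ineq[of "(2 * real k + 3) * poly ((pderiv ^^ r) (legendre_poly (k + 1))) t"
          "poly ((pderiv ^^ Suc r) (legendre_poly k)) t"]
      by (simp add: abs_mult del: funpow.simps)
    also have "\<dots> \<le> (2 * real k + 3) * real (k + 2) ^ (2 * r) + real k ^ 2 * real (k + 2) ^ (2 * r)"
    proof (intro add_mono mult_left_mono)
      show "\<bar>poly ((pderiv ^^ r) (legendre_poly (k + 1))) t\<bar> \<le> real (k + 2) ^ (2 * r)"
        using Suc[of "k + 1"] by (rule order_trans) (intro power_mono, auto)
      have "\<bar>poly ((pderiv ^^ Suc r) (legendre_poly k)) t\<bar> \<le> real k ^ 2 * real k ^ (2 * r)"
        using ge2(1) by (simp add: power2_eq_square mult_ac)
      also have "\<dots> \<le> real k ^ 2 * real (k + 2) ^ (2 * r)"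
        by (intro mult_left_mono power_mono) auto
      finally show "\<bar>poly ((pderiv ^^ Suc r) (legendre_poly k)) t\<bar> \<le> real k ^ 2 * real (k + 2) ^ (2 * r)" .
    qed simp
    also have "\<dots> = ((2 * real k + 3) + real k ^ 2) * real (k + 2) ^ (2 * r)" by (simp add: algebra_simps)
    also have "\<dots> \<le> real (k + 2) ^ 2 * real (k + 2) ^ (2 * r)"
      by (intro mult_right_mono) (auto simp: power2_eq_square algebra_simps)
    finally show ?case by (simp add: power_add[symmetric])
  qed
qed

text \<open>The additional exponent \<open>1/2\<close> comes from the normalisation in \<open>L\<^sub>2\<close>.\<close>

lemma abs_higher_deriv_legendre_le:
  assumes "\<bar>t\<bar> \<le> 1" "k \<ge> 1"
  shows "\<bar>(deriv ^^ r) (legendre k) t\<bar> \<le> 2 * real k powr (2 * real r + 1/2)"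
proof -
  have "\<bar>(deriv ^^ r) (legendre k) t\<bar> = sqrt (real k + 1/2) * \<bar>poly ((pderiv ^^ r) (legendre_poly k)) t\<bar>"
    by (simp add: legendre_eq_poly higher_deriv_poly higher_pderiv_smult abs_mult)
  also have "\<dots> \<le> (2 * sqrt (real k)) * real k ^ (2 * r)"
  proof (intro mult_mono abs_higher_pderiv_legendre_poly_le assms)
    have "sqrt (real k + 1/2) \<le> sqrt (4 * real k)" using assms by simp
    then show "sqrt (real k + 1/2) \<le> 2 * sqrt (real k)" by (simp add: real_sqrt_mult)
  qed auto
  also have "\<dots> = 2 * real k powr (2 * real r + 1/2)"
    using assms by (simp add: powr_add powr_half_sqrt powr_realpow[symmetric])
  finally show ?thesis .
qed

lemma continuous_on_higher_deriv_legendre: "continuous_on A ((deriv ^^ r) (legendre k))"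
  by (simp add: legendre_eq_poly higher_deriv_poly) (intro continuous_intros)

section \<open>Weighted sums of sequences\<close>

text \<open>A normalised form of Hoelder's inequality, obtained by applying Young's inequality to each
  summand. In this form the exponents \<open>s = 1\<close> and \<open>s > 1\<close> need no separate treatment, because the
  conjugate exponent occurs only through \<open>1 - 1/s\<close>.\<close>

lemma sum_mult_powr_le_by_Young:
  fixes b y :: "'a \<Rightarrow> real"
  assumes "s \<ge> 1" "finite A" "\<And>k. k \<in> A \<Longrightarrow> b k \<ge> 0" "\<And>k. k \<in> A \<Longrightarrow> y k > 0"
    and "(\<Sum>k\<in>A. b k powr s) \<le> 1" and "(\<Sum>k\<in>A. y k) \<le> K"
  shows "(\<Sum>k\<in>A. b k * y k powr (1 - 1/s)) \<le> 1 + K"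
proof -
  have "b k * y k powr (1 - 1/s) \<le> b k powr s + y k" if k: "k \<in> A" for k
  proof (cases "b k = 0")
    case False
    then have b: "b k > 0" using assms(3)[OF k] by simp
    have "(b k powr s) powr (1/s) * y k powr (1 - 1/s) \<le> (1/s) * b k powr s + (1 - 1/s) * y k"
      by (rule Youngs_inequality_0) (use assms b k in auto)
    also have "\<dots> \<le> 1 * b k powr s + 1 * y k"
      using assms(1) assms(4)[OF k] by (intro add_mono mult_right_mono) auto
    finally show ?thesis using b assms(1) by (simp add: powr_powr)
  qed (use assms(4)[OF k] in simp)
  then have "(\<Sum>k\<in>A. b k * y k powr (1 - 1/s)) \<le> (\<Sum>k\<in>A. b k powr s + y k)"
    by (rule sum_mono)
  with assms(5,6) show ?thesis by (simp add: sum.distrib)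
qed

text \<open>Comparison with the integral of \<open>x\<^bsup>-1-\<sigma>\<^esup>\<close>, in telescoping form so that induction applies.\<close>

lemma sum_powr_tail_le:
  fixes \<sigma> :: real
  assumes "\<sigma> > 0" "N \<ge> 1" "n \<ge> N"
  shows "(\<Sum>k=N+1..n. real k powr (-1-\<sigma>)) \<le> (real N powr -\<sigma> - real n powr -\<sigma>) / \<sigma>"
  using assms(3)
proof (induction n rule: dec_induct)
  case (step n)
  have n: "real n > 0" using assms(2) step by simp
  have "\<exists>z>real n. z < real n + 1 \<and> (real n + 1) powr -\<sigma> - real n powr -\<sigma>
          = (real n + 1 - real n) * (-\<sigma> * z powr (-\<sigma> - 1))"
    by (rule MVT2) (use n in \<open>auto intro!: derivative_eq_intros simp: field_simps powr_diff\<close>)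
  then obtain z where z: "z > real n" "z < real n + 1"
    "(real n + 1) powr -\<sigma> - real n powr -\<sigma> = -\<sigma> * z powr (-1-\<sigma>)" using minus_diff_commute[of \<sigma> 1] by auto
  have "(real n + 1) powr (-1-\<sigma>) \<le> z powr (-1-\<sigma>)"
    by (rule powr_mono2') (use z n assms(1) in auto)
  also have "\<dots> = (real n powr -\<sigma> - (real n + 1) powr -\<sigma>) / \<sigma>"
    using z(3) assms(1) by (simp add: field_simps)
  finally have "real (Suc n) powr (-1-\<sigma>) \<le> (real n powr -\<sigma> - real (Suc n) powr -\<sigma>) / \<sigma>"
    by (simp add: add.commute)
  then show ?case using step by (simp add: diff_divide_distrib)
qed simp

text \<open>Hoelder's inequality with the weights \<open>y\<^sub>k = N\<^sup>\<sigma> k\<^bsup>-1-\<sigma>\<^esup>\<close>, whose sum over \<open>k > N\<close> is at most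
  \<open>1/\<sigma>\<close> for every \<open>N\<close>. After the factor \<open>k\<^sup>\<mu>\<close> is moved to the coefficients, what remains is
  \<open>k\<^bsup>\<alpha>-\<mu>\<^esup>\<close>; for \<open>k > N\<close> it is at most \<open>N\<^bsup>-\<sigma>\<^esup>\<close> times the power \<open>1 - 1/s\<close> of \<open>y\<^sub>k\<close>.\<close>

lemma weighted_tail_le:
  fixes a :: "nat \<Rightarrow> real" and \<alpha> \<mu> s :: real
  defines "\<sigma> \<equiv> \<mu> - \<alpha> - 1 + 1 / s"
  assumes s: "s \<ge> 1" and "\<sigma> > 0" "N \<ge> 1" "n \<ge> N"
    and a: "(\<Sum>k=N+1..n. (real k powr \<mu> * \<bar>a k\<bar>) powr s) \<le> 1"
  shows "(\<Sum>k=N+1..n. \<bar>a k\<bar> * real k powr \<alpha>) \<le> (1 + 1/\<sigma>) * real N powr -\<sigma>"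
proof -
  define \<theta> where "\<theta> = 1 - 1/s"
  have th: "0 \<le> \<theta>" "\<theta> \<le> 1" using s by (auto simp: \<theta>_def)
  define y where "y k = real N powr \<sigma> * real k powr (-1-\<sigma>)" for k
  have N: "real N > 0" using assms by simp
  have summand: "\<bar>a k\<bar> * real k powr \<alpha> \<le> real N powr -\<sigma> * ((real k powr \<mu> * \<bar>a k\<bar>) * y k powr \<theta>)"
    if "k \<in> {N+1..n}" for k
  proof -
    have k: "real k > 0" "real N \<le> real k" using that by auto
    \<comment> \<open>the surplus of decay that the weight \<open>y k powr \<theta>\<close> does not use\<close>
    have "real k powr (-(\<sigma> * (1-\<theta>))) \<le> real N powr (-(\<sigma> * (1-\<theta>)))"
      by (rule powr_mono2') (use k N th \<open>\<sigma> > 0\<close> in auto)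
    then have "real k powr \<mu> * real k powr (\<theta> * (-1-\<sigma>)) * real k powr (-(\<sigma> * (1-\<theta>)))
       \<le> real k powr \<mu> * real k powr (\<theta> * (-1-\<sigma>)) * real N powr (-(\<sigma> * (1-\<theta>)))"
      by (intro mult_left_mono) auto
    moreover have "real k powr \<mu> * real k powr (\<theta> * (-1-\<sigma>)) * real k powr (-(\<sigma> * (1-\<theta>))) = real k powr \<alpha>"
      unfolding powr_add[symmetric]
      by (rule arg_cong[where f="\<lambda>e. real k powr e"]) (simp add: \<sigma>_def \<theta>_def algebra_simps add_divide_distrib)
    moreover have "real N powr (-(\<sigma> * (1-\<theta>))) = real N powr -\<sigma> * real N powr (\<sigma> * \<theta>)"
      unfolding powr_add[symmetric]
      by (rule arg_cong[where f="\<lambda>e. real N powr e"]) (simp add: algebra_simps)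
    moreover have "y k powr \<theta> = real N powr (\<sigma> * \<theta>) * real k powr (\<theta> * (-1-\<sigma>))"
      by (simp add: y_def powr_mult powr_powr mult.commute)
    ultimately have "real k powr \<alpha> \<le> real N powr -\<sigma> * (real k powr \<mu> * y k powr \<theta>)"
      by (simp add: mult_ac)
    from mult_left_mono[OF this, of "\<bar>a k\<bar>"] show ?thesis by (simp add: mult_ac)
  qed
  have "(\<Sum>k=N+1..n. y k) \<le> real N powr \<sigma> * ((real N powr -\<sigma> - real n powr -\<sigma>) / \<sigma>)"
    unfolding y_def sum_distrib_left[symmetric]
    by (intro mult_left_mono sum_powr_tail_le) (use assms in auto)
  also have "\<dots> \<le> real N powr \<sigma> * (real N powr -\<sigma> / \<sigma>)"
    using \<open>\<sigma> > 0\<close> by (intro mult_left_mono divide_right_mono) auto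
  also have "\<dots> = 1 / \<sigma>" using N by (simp add: powr_minus)
  finally have y: "(\<Sum>k=N+1..n. y k) \<le> 1 / \<sigma>" .
  have "(\<Sum>k=N+1..n. \<bar>a k\<bar> * real k powr \<alpha>)
      \<le> real N powr -\<sigma> * (\<Sum>k=N+1..n. (real k powr \<mu> * \<bar>a k\<bar>) * y k powr \<theta>)"
    unfolding sum_distrib_left by (rule sum_mono) (rule summand)
  also have "\<dots> \<le> real N powr -\<sigma> * (1 + 1/\<sigma>)"
    unfolding \<theta>_def
    by (intro mult_left_mono sum_mult_powr_le_by_Young) (use s a y N in \<open>auto simp: y_def\<close>)
  finally show ?thesis by (simp add: mult.commute)
qed

lemma sum_le_of_suminf_powr_le:
  fixes x :: "nat \<Rightarrow> real"
  assumes "summable x" "\<And>k. x k \<ge> 0" "(\<Sum>k. x k) powr e \<le> d" "e > 0" "d > 0" "finite A"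
  shows "sum x A \<le> d powr (1/e)"
proof -
  have "sum x A \<le> suminf x" using assms by (intro sum_le_suminf) auto
  also have "\<dots> = (suminf x powr e) powr (1/e)"
    using assms by (simp add: powr_powr suminf_nonneg)
  also have "\<dots> \<le> d powr (1/e)" using assms by (intro powr_mono2) auto
  finally show ?thesis .
qed

lemma sum_wiener_coeff_le_1:
  assumes s: "s \<ge> 1" and f: "f \<in> wiener_class s \<mu>" and "wiener_norm s \<mu> f \<le> 1"
    and A: "finite A" "0 \<notin> A"
  shows "(\<Sum>k\<in>A. (real k powr \<mu> * \<bar>legendre_coeff f k\<bar>) powr s) \<le> 1"
proof -
  let ?x = "\<lambda>k. max 1 (real k) powr (s * \<mu>) * \<bar>legendre_coeff f k\<bar> powr s"
  have "sum ?x A \<le> 1 powr (1 / (1/s))"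
    by (rule sum_le_of_suminf_powr_le) (use assms in \<open>auto simp: wiener_class_def wiener_norm_def\<close>)
  moreover have "(real k powr \<mu> * \<bar>legendre_coeff f k\<bar>) powr s = ?x k" if "k \<in> A" for k
  proof -
    have "k \<noteq> 0" using that A by metis
    then show ?thesis by (simp add: powr_mult powr_powr max_def mult.commute)
  qed
  ultimately show ?thesis by simp
qed

text \<open>For finite \<open>p\<close> this is Hoelder's inequality against a constant sequence, with the weights
  \<open>1/N\<close> in the normalised form above. The factor \<open>2\<close> is the price of using Young's inequality.\<close>

lemma sum_le_lp_norm:
  assumes p: "p \<ge> 1" and x: "x \<in> lp_space p" and d: "lp_norm p x \<le> \<delta>" "\<delta> > 0" and N: "N \<ge> 1"
  shows "(\<Sum>k=1..N. \<bar>x k\<bar>) \<le> 2 * \<delta> * real N powr (1 - real_of_ereal (1/p))"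
proof (cases "p = \<infinity>")
  case True
  have "\<bar>x k\<bar> \<le> \<delta>" for k
  proof -
    have "bdd_above (range (\<lambda>k. \<bar>x k\<bar>))"
      using x True by (auto simp: lp_space_def bounded_iff bdd_above_def)
    then have "\<bar>x k\<bar> \<le> (SUP k. \<bar>x k\<bar>)" by (rule cSUP_upper2) auto
    with d True show ?thesis by (simp add: lp_norm_def)
  qed
  then have "(\<Sum>k=1..N. \<bar>x k\<bar>) \<le> (\<Sum>k=1..N. \<delta>)" by (intro sum_mono)
  also have "\<dots> \<le> 2 * \<delta> * real N" using d N by simp
  finally show ?thesis using True N by simp
next
  case False
  then obtain q where q: "p = ereal q" "q \<ge> 1" using p by (cases p) auto
  have N': "real N > 0" using N by simp
  have "(\<Sum>k=1..N. \<bar>x k\<bar> powr q) \<le> \<delta> powr (1 / (1/q))"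
    by (rule sum_le_of_suminf_powr_le) (use x d q in \<open>auto simp: lp_space_def lp_norm_def\<close>)
  then have "(\<Sum>k=1..N. (\<bar>x k\<bar> / \<delta>) powr q) \<le> 1"
    using d by (simp add: powr_divide sum_divide_distrib[symmetric])
  then have "(\<Sum>k=1..N. \<bar>x k\<bar> / \<delta> * (1 / real N) powr (1 - 1/q)) \<le> 1 + 1"
    by (intro sum_mult_powr_le_by_Young) (use q d N' in auto)
  then have "(\<Sum>k=1..N. \<bar>x k\<bar>) / (\<delta> * real N powr (1 - 1/q)) \<le> 2"
    by (simp add: powr_divide sum_distrib_right[symmetric] sum_divide_distrib[symmetric])
  then show ?thesis using d N' q by (simp add: divide_le_eq mult_ac one_ereal_def)
qed

section \<open>The error of the truncation method\<close>

lemma truncation_diff: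
  assumes "r \<le> N" "N \<le> n"
  shows "truncation r n a t - truncation r N a t = (\<Sum>k=N+1..n. a k * (deriv ^^ r) (legendre k) t)"
proof -
  have "{r..n} = {r..N} \<union> {N+1..n}" "{r..N} \<inter> {N+1..n} = {}" using assms by auto
  then show ?thesis by (simp add: truncation_def sum.union_disjoint)
qed

lemma abs_sum_higher_deriv_legendre_le:
  assumes "\<bar>t\<bar> \<le> 1" "0 \<notin> A"
  shows "\<bar>\<Sum>k\<in>A. a k * (deriv ^^ r) (legendre k) t\<bar> \<le> 2 * (\<Sum>k\<in>A. \<bar>a k\<bar> * real k powr (2 * real r + 1/2))"
proof -
  have "\<bar>\<Sum>k\<in>A. a k * (deriv ^^ r) (legendre k) t\<bar> \<le> (\<Sum>k\<in>A. \<bar>a k * (deriv ^^ r) (legendre k) t\<bar>)"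
    by (rule sum_abs)
  also have "\<dots> \<le> (\<Sum>k\<in>A. \<bar>a k\<bar> * (2 * real k powr (2 * real r + 1/2)))"
  proof (rule sum_mono)
    fix k assume "k \<in> A"
    then have "k \<noteq> 0" using assms(2) by metis
    then show "\<bar>a k * (deriv ^^ r) (legendre k) t\<bar> \<le> \<bar>a k\<bar> * (2 * real k powr (2 * real r + 1/2))"
      unfolding abs_mult by (intro mult_left_mono abs_higher_deriv_legendre_le assms(1)) auto
  qed
  finally show ?thesis by (simp add: sum_distrib_left mult_ac)
qed

text \<open>The bias of the method: the coefficients in the Wiener class decay fast enough to absorb the
  growth \<open>k\<^bsup>2 r + 1/2\<^esup>\<close> of the differentiated Legendre polynomials.\<close>

lemma truncation_tail_le:
  fixes r :: nat and s \<mu> :: real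
  defines "\<sigma> \<equiv> \<mu> - 2 * real r + 1 / s - 3 / 2"
  assumes "s \<ge> 1" "\<sigma> > 0" and f: "f \<in> wiener_class s \<mu>" "wiener_norm s \<mu> f \<le> 1"
    and "N \<ge> 1" "r \<le> N" "N \<le> n" and t: "\<bar>t\<bar> \<le> 1"
  shows "\<bar>truncation r n (legendre_coeff f) t - truncation r N (legendre_coeff f) t\<bar>
           \<le> 2 * (1 + 1/\<sigma>) * real N powr -\<sigma>"
proof -
  \<comment> \<open>the exponent \<open>\<sigma>\<close> of the weighted tail estimate for \<open>\<alpha> = 2 r + 1/2\<close>\<close>
  have eq: "\<mu> - (2 * real r + 1/2) - 1 + 1/s = \<sigma>" by (simp add: \<sigma>_def)
  have "(\<Sum>k=N+1..n. (real k powr \<mu> * \<bar>legendre_coeff f k\<bar>) powr s) \<le> 1"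
    by (rule sum_wiener_coeff_le_1) (use assms in auto)
  then have "(\<Sum>k=N+1..n. \<bar>legendre_coeff f k\<bar> * real k powr (2 * real r + 1/2))
      \<le> (1 + 1/\<sigma>) * real N powr -\<sigma>"
    using weighted_tail_le[of s \<mu> "2 * real r + 1/2" N n "legendre_coeff f"] assms
    unfolding eq by blast
  moreover have "\<bar>\<Sum>k=N+1..n. legendre_coeff f k * (deriv ^^ r) (legendre k) t\<bar>
      \<le> 2 * (\<Sum>k=N+1..n. \<bar>legendre_coeff f k\<bar> * real k powr (2 * real r + 1/2))"
    by (rule abs_sum_higher_deriv_legendre_le[OF t]) simp
  ultimately show ?thesis
    unfolding truncation_diff[OF \<open>r \<le> N\<close> \<open>N \<le> n\<close>] mult.assoc by linarith
qed

text \<open>The tail estimate is uniform in \<open>t\<close> and in the upper index. So it first makes the partial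
  sums uniformly Cauchy, which gives the derivative, and then passes to the limit as a bound for the
  truncation error.\<close>

lemma has_C_derivative_truncation_error:
  fixes r :: nat and s \<mu> :: real
  defines "\<sigma> \<equiv> \<mu> - 2 * real r + 1 / s - 3 / 2"
  assumes s: "s \<ge> 1" and \<sigma>: "\<sigma> > 0" and f: "f \<in> wiener_class s \<mu>" "wiener_norm s \<mu> f \<le> 1"
  obtains g where "has_C_derivative r f g"
    and "\<And>N t. N \<ge> 1 \<Longrightarrow> r \<le> N \<Longrightarrow> \<bar>t\<bar> \<le> 1 \<Longrightarrow>
           \<bar>g t - truncation r N (legendre_coeff f) t\<bar> \<le> 2 * (1 + 1/\<sigma>) * real N powr -\<sigma>"
proof -
  let ?S = "\<lambda>n. truncation r n (legendre_coeff f)"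
  define K where "K = 2 * (1 + 1/\<sigma>)"
  have K: "K > 0" using \<sigma> by (simp add: K_def add_pos_pos)
  have tail: "\<bar>?S n t - ?S N t\<bar> \<le> K * real N powr -\<sigma>"
    if "N \<ge> 1" "r \<le> N" "N \<le> n" "\<bar>t\<bar> \<le> 1" for n N t
    unfolding K_def \<sigma>_def by (rule truncation_tail_le) (use s \<sigma> f that in \<open>auto simp: \<sigma>_def\<close>)
  have "uniformly_Cauchy_on {-1..1} ?S"
  proof (rule uniformly_Cauchy_onI')
    fix e :: real assume "e > 0"
    have "(\<lambda>N. K * real N powr -\<sigma>) \<longlonglongrightarrow> K * 0"
      using \<sigma> by (intro tendsto_mult tendsto_const tendsto_neg_powr filterlim_real_sequentially) auto
    then have "\<forall>\<^sub>F N in sequentially. K * real N powr -\<sigma> < e"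
      using \<open>e > 0\<close> by (auto dest: order_tendstoD(2))
    then obtain M where M: "\<And>N. N \<ge> M \<Longrightarrow> K * real N powr -\<sigma> < e"
      by (auto simp: eventually_sequentially)
    show "\<exists>M. \<forall>x\<in>{-1..1}. \<forall>m\<ge>M. \<forall>n>m. dist (?S m x) (?S n x) < e"
    proof (intro exI[of _ "max M (max 1 r)"] ballI allI impI)
      fix x :: real and m n assume *: "x \<in> {-1..1}" "m \<ge> max M (max 1 r)" "n > m"
      then have "\<bar>?S n x - ?S m x\<bar> \<le> K * real m powr -\<sigma>" by (intro tail) auto
      also have "\<dots> < e" using * by (intro M) auto
      finally show "dist (?S m x) (?S n x) < e" by (simp add: dist_real_def)
    qed
  qed
  then obtain g where g: "uniform_limit {-1..1} ?S g sequentially"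
    using Cauchy_uniformly_convergent uniformly_convergent_on_def by blast
  have "continuous_on {-1..1} (?S n)" for n
    unfolding truncation_def by (intro continuous_intros continuous_on_higher_deriv_legendre)
  then have "continuous_on {-1..1} g"
    by (intro uniform_limit_theorem[OF _ g]) auto
  with g have "has_C_derivative r f g" by (simp add: has_C_derivative_def)
  moreover have "\<bar>g t - ?S N t\<bar> \<le> K * real N powr -\<sigma>" if N: "N \<ge> 1" "r \<le> N" and t: "\<bar>t\<bar> \<le> 1" for N t
  proof -
    have "(\<lambda>n. ?S n t) \<longlonglongrightarrow> g t" by (rule tendsto_uniform_limitI[OF g]) (use t in auto)
    then have "(\<lambda>n. \<bar>?S n t - ?S N t\<bar>) \<longlonglongrightarrow> \<bar>g t - ?S N t\<bar>" by (intro tendsto_intros)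
    then show ?thesis by (rule Lim_bounded) (use tail N t in blast)
  qed
  ultimately show thesis using that unfolding K_def by blast
qed

text \<open>The propagated data error: all factors \<open>k\<^bsup>2 r + 1/2\<^esup>\<close> are replaced by the largest one, and the
  remaining sum of absolute values is compared with the \<open>\<ell>\<^sub>p\<close> norm, which contributes \<open>N\<^bsup>1 - 1/p\<^esup>\<close>.\<close>

lemma truncation_noise_le:
  assumes r: "r \<ge> 1" and p: "p \<ge> 1" and N: "N \<ge> r" and \<delta>: "\<delta> > 0" and t: "\<bar>t\<bar> \<le> 1"
    and \<xi>: "(\<lambda>k. a k - b k) \<in> lp_space p" "lp_norm p (\<lambda>k. a k - b k) \<le> \<delta>"
  shows "\<bar>truncation r N a t - truncation r N b t\<bar>
     \<le> 4 * \<delta> * real N powr (2 * real r + 3/2 - real_of_ereal (1/p))"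
proof -
  have "\<bar>truncation r N a t - truncation r N b t\<bar>
      = \<bar>\<Sum>k=r..N. (a k - b k) * (deriv ^^ r) (legendre k) t\<bar>"
    by (simp add: truncation_def sum_subtractf left_diff_distrib)
  also have "\<dots> \<le> 2 * (\<Sum>k=r..N. \<bar>a k - b k\<bar> * real k powr (2 * real r + 1/2))"
    by (rule abs_sum_higher_deriv_legendre_le) (use t r in auto)
  also have "(\<Sum>k=r..N. \<bar>a k - b k\<bar> * real k powr (2 * real r + 1/2))
      \<le> (\<Sum>k=r..N. \<bar>a k - b k\<bar> * real N powr (2 * real r + 1/2))"
    by (intro sum_mono mult_left_mono powr_mono2) auto
  also have "\<dots> \<le> (\<Sum>k=1..N. \<bar>a k - b k\<bar> * real N powr (2 * real r + 1/2))"
    by (rule sum_mono2) (use r in auto)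
  also have "\<dots> = (\<Sum>k=1..N. \<bar>a k - b k\<bar>) * real N powr (2 * real r + 1/2)"
    by (simp add: sum_distrib_right)
  also have "\<dots> \<le> 2 * \<delta> * real N powr (1 - real_of_ereal (1/p)) * real N powr (2 * real r + 1/2)"
    by (intro mult_right_mono sum_le_lp_norm[OF p \<xi> \<delta>]) (use r N in auto)
  also have "\<dots> = 2 * \<delta> * real N powr (2 * real r + 3/2 - real_of_ereal (1/p))"
    by (simp add: mult.assoc powr_add[symmetric] algebra_simps)
  finally show ?thesis by simp
qed

theorem theorem2p3:
  fixes r :: nat and s \<mu> C1 C2 :: real and p :: ereal
  assumes "r \<ge> 1" and "s \<ge> 1" and "p \<ge> 1"
    and "\<mu> > 2 * real r - 1 / s + 3 / 2"
    and "C1 > 0" and "C2 > 0"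
  shows "\<exists>c>0. \<forall>(\<delta>::real) (f :: real \<Rightarrow> real) (f\<delta> :: nat \<Rightarrow> real) (N :: nat).
     0 < \<delta> \<longrightarrow> \<delta> < 1 \<longrightarrow>
     f \<in> wiener_class s \<mu> \<longrightarrow> wiener_norm s \<mu> f \<le> 1 \<longrightarrow>
     (\<lambda>k. legendre_coeff f k - f\<delta> k) \<in> lp_space p \<longrightarrow>
     lp_norm p (\<lambda>k. legendre_coeff f k - f\<delta> k) \<le> \<delta> \<longrightarrow>
     N \<ge> r \<longrightarrow>
     C1 * \<delta> powr (- (1 / (\<mu> - real_of_ereal (1 / p) + 1 / s))) \<le> real N \<longrightarrow>
     real N \<le> C2 * \<delta> powr (- (1 / (\<mu> - real_of_ereal (1 / p) + 1 / s))) \<longrightarrow>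
     (\<exists>g. has_C_derivative r f g \<and>
        C_norm (\<lambda>t. g t - truncation r N f\<delta> t)
          \<le> c * \<delta> powr ((\<mu> - 2 * real r + 1 / s - 3 / 2)
                        / (\<mu> - real_of_ereal (1 / p) + 1 / s)))"
proof -
  define q where "q = real_of_ereal (1 / p)"
  have q: "q \<le> 1"
    using \<open>p \<ge> 1\<close> by (cases p) (auto simp: q_def one_ereal_def)
  define \<sigma> where "\<sigma> = \<mu> - 2 * real r + 1 / s - 3 / 2"
  \<comment> \<open>With \<open>N \<asymp> \<delta>\<^bsup>-1/E\<^esup>\<close>, the bias is of order \<open>N\<^bsup>-\<sigma>\<^esup>\<close> and the propagated data error of order
    \<open>\<delta> N\<^sup>e\<close>. Since \<open>E = \<sigma> + e\<close>, both are of order \<open>\<delta>\<^bsup>\<sigma>/E\<^esup>\<close>.\<close>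
  define E where "E = \<mu> - q + 1 / s"
  define e where "e = 2 * real r + 3/2 - q"
  have \<sigma>: "\<sigma> > 0" using assms(4) by (simp add: \<sigma>_def)
  have E: "E = \<sigma> + e" by (simp add: E_def \<sigma>_def e_def)
  have e: "e > 0" using q by (simp add: e_def)
  have Epos: "E > 0" using E e \<sigma> by simp
  define K where "K = 2 * (1 + 1/\<sigma>)"
  have K: "K > 0" using \<sigma> by (simp add: K_def add_pos_pos)
  define c where "c = K * C1 powr -\<sigma> + 4 * C2 powr e"
  have "c > 0" using K assms by (simp add: c_def add_pos_pos)
  moreover have "\<exists>g. has_C_derivative r f g \<and>
      C_norm (\<lambda>t. g t - truncation r N f\<delta> t) \<le> c * \<delta> powr (\<sigma> / E)"
    if \<delta>: "0 < \<delta>" "\<delta> < 1" and f: "f \<in> wiener_class s \<mu>" "wiener_norm s \<mu> f \<le> 1"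
      and \<xi>: "(\<lambda>k. legendre_coeff f k - f\<delta> k) \<in> lp_space p"
        "lp_norm p (\<lambda>k. legendre_coeff f k - f\<delta> k) \<le> \<delta>"
      and N: "N \<ge> r" "C1 * \<delta> powr (- (1 / E)) \<le> real N" "real N \<le> C2 * \<delta> powr (- (1 / E))"
    for \<delta> f f\<delta> N
  proof -
    obtain g where g: "has_C_derivative r f g" and
      g': "\<And>N t. N \<ge> 1 \<Longrightarrow> r \<le> N \<Longrightarrow> \<bar>t\<bar> \<le> 1 \<Longrightarrow>
             \<bar>g t - truncation r N (legendre_coeff f) t\<bar> \<le> K * real N powr -\<sigma>"
      using has_C_derivative_truncation_error[of s \<mu> r f] \<open>s \<ge> 1\<close> \<sigma> f
      unfolding K_def \<sigma>_def by blast
    have "real N powr -\<sigma> \<le> (C1 * \<delta> powr (- (1 / E))) powr -\<sigma>"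
      by (rule powr_mono2') (use N \<sigma> \<delta> \<open>C1 > 0\<close> in auto)
    also have "\<dots> = C1 powr -\<sigma> * \<delta> powr (\<sigma> / E)"
      by (simp add: powr_mult powr_powr)
    finally have bias: "real N powr -\<sigma> \<le> C1 powr -\<sigma> * \<delta> powr (\<sigma> / E)" .
    have "\<delta> * real N powr e \<le> \<delta> * (C2 * \<delta> powr (- (1 / E))) powr e"
      by (intro mult_left_mono powr_mono2) (use N e \<delta> in auto)
    also have "\<dots> = C2 powr e * (\<delta> powr 1 * \<delta> powr (- (e / E)))"
      using \<delta> by (simp add: powr_mult powr_powr)
    also have "\<dots> = C2 powr e * \<delta> powr (\<sigma> / E)"
      unfolding powr_add[symmetric] using E Epos by (simp add: field_simps)
    finally have noise: "\<delta> * real N powr e \<le> C2 powr e * \<delta> powr (\<sigma> / E)" .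
    have "\<bar>g t - truncation r N f\<delta> t\<bar> \<le> c * \<delta> powr (\<sigma> / E)" if t: "t \<in> {-1..1}" for t
    proof -
      have "\<bar>g t - truncation r N f\<delta> t\<bar> \<le> \<bar>g t - truncation r N (legendre_coeff f) t\<bar>
          + \<bar>truncation r N (legendre_coeff f) t - truncation r N f\<delta> t\<bar>" by simp
      also have "\<dots> \<le> K * real N powr -\<sigma> + 4 * \<delta> * real N powr e"
        unfolding e_def q_def
        by (intro add_mono g' truncation_noise_le) (use assms N t \<delta> \<xi> in auto)
      also have "\<dots> \<le> K * (C1 powr -\<sigma> * \<delta> powr (\<sigma> / E)) + 4 * (C2 powr e * \<delta> powr (\<sigma> / E))"
        unfolding mult.assoc by (intro add_mono mult_left_mono bias noise) (use K in auto)
      finally show ?thesis by (simp add: c_def algebra_simps)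
    qed
    then have "C_norm (\<lambda>t. g t - truncation r N f\<delta> t) \<le> c * \<delta> powr (\<sigma> / E)"
      unfolding C_norm_def by (intro cSUP_least) auto
    with g show ?thesis by blast
  qed
  ultimately show ?thesis
    unfolding \<sigma>_def[symmetric] q_def[symmetric] E_def[symmetric] by (intro exI[of _ c]) blast
qed

end
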